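(* Consider the discrete-time linear time-invariant system $\xi_{k+1}=A\xi_k+Bu_k$, $y_k=C\xi_k$, $\xi_0\in\mathbb{R}^{nd}$, with input $u_k\in\mathbb{R}^d$ and output $y_k\in\mathbb{R}^d$, where $A\in\mathbb{R}^{nd\times nd}$, $B\in\mathbb{R}^{nd\times d}$, $C\in\mathbb{R}^{d\times nd}$ are all of Kronecker form $(\cdot)\otimes I_d$. If this system has relative degree $r\ge 1$, then it can be rewritten as $$\begin{bmatrix}\tilde\xi^{(1)}_{k+1}\\ \tilde\xi^{(2)}_{k+1}\\ y_k\end{bmatrix}=\begin{bmatrix}y_{k+r}\\ \vdots\\ y_{k+1}\\ \tilde\xi^{(2)}_{k+1}\\ y_k\end{bmatrix}=\begin{bmatrix}\tilde A&\tilde B\\ \tilde C&0\end{bmatrix}\begin{bmatrix}y_{k+r-1}\\ \vdots\\ y_k\\ \tilde\xi^{(2)}_k\\ u_k\end{bmatrix}=\begin{bmatrix}\tilde A_{11}&\tilde A_{12}&\tilde B_1\\ \tilde A_{21}&\tilde A_{22}&0\\ \tilde C_1&0&0\end{bmatrix}\begin{bmatrix}y_{k+r-1}\\ \vdots\\ y_k\\ \tilde\xi^{(2)}_k\\ u_k\end{bmatrix},$$ where $$\tilde A_{11}=\begin{bmatrix}\star&\star&\cdots&\star\\ I_d&0&\cdots&0\\ \vdots&\ddots&\ddots&\vdots\\ 0&\cdots&I_d&0\end{bmatrix}\in\mathbb{R}^{rd\times rd},\quad \tilde A_{12}=\begin{bmatrix}\star\\0\\ \vdots\\0\end{bmatrix}\in\mathbb{R}^{rd\times(n-r)d},$$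 $$\tilde B_1=e_1\otimes CA^{r-1}B\in\mathbb{R}^{rd\times d},\qquad \tilde C_1=\begin{bmatrix}0&\cdots&0&I_d\end{bmatrix}\in\mathbb{R}^{d\times rd},$$ and $e_1\in\mathbb{R}^r$ is the first standard basis vector.
   Context: Here $n,d$ are positive integers. The relative degree of the system $(A,B,C)$ is the smallest integer $r\ge1$ such that $CA^{r-1}B\neq0$, i.e. $y_{k+r}$ explicitly depends on $u_k$. A matrix is of Kronecker form $(\cdot)\otimes I_d$ if it equals $X\otimes I_d$ for some real matrix $X$. In the rewritten system the input $u_k$ and output $y_k$ are those of the original system; the state is $\tilde\xi_k=(\tilde\xi^{(1)}_k,\tilde\xi^{(2)}_k)$ with first part $\tilde\xi^{(1)}_k=(y_{k+r-1},\dots,y_k)\in\mathbb{R}^{rd}$ and a remaining part $\tilde\xi^{(2)}_k$. The blocks $\tilde A_{ij}$, $\tilde B_1$, $\tilde C_1$ are the blocks of $\tilde A$, $\tilde B$, $\tilde C$ for this partition of the state. Each $\star$ denotes an unspecified real block, and $\tilde A_{21},\tilde A_{22}$ are unspecified real matrices. *)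

theory Defs
  imports Complex_Main "Jordan_Normal_Form.Matrix"
begin

definition kron :: "real mat \<Rightarrow> real mat \<Rightarrow> real mat" (infixl \<open>\<otimes>\<^sub>k\<close> 70) where
  "X \<otimes>\<^sub>k Y = mat (dim_row X * dim_row Y) (dim_col X * dim_col Y)
     (\<lambda>(i, j). X $$ (i div dim_row Y, j div dim_col Y) * Y $$ (i mod dim_row Y, j mod dim_col Y))"

definition kronecker_form :: "nat \<Rightarrow> real mat \<Rightarrow> bool" where
  "kronecker_form d M \<longleftrightarrow> (\<exists>X. M = X \<otimes>\<^sub>k 1\<^sub>m d)"

definition has_relative_degree :: "real mat \<Rightarrow> real mat \<Rightarrow> real mat \<Rightarrow> nat \<Rightarrow> bool" where
  "has_relative_degree A B C r \<longleftrightarrow>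
     1 \<le> r \<and> C * A ^\<^sub>m (r - 1) * B \<noteq> 0\<^sub>m (dim_row C) (dim_col B) \<and>
     (\<forall>s. 1 \<le> s \<and> s < r \<longrightarrow> C * A ^\<^sub>m (s - 1) * B = 0\<^sub>m (dim_row C) (dim_col B))"

text \<open>Trajectories from an arbitrary initial state \<open>\<xi> 0\<close> under an arbitrary input sequence \<open>u\<close>.\<close>

definition lti_trajectory ::
  "real mat \<Rightarrow> real mat \<Rightarrow> real mat \<Rightarrow> (nat \<Rightarrow> real vec) \<Rightarrow> (nat \<Rightarrow> real vec) \<Rightarrow> (nat \<Rightarrow> real vec) \<Rightarrow> bool" where
  "lti_trajectory A B C \<xi> u y \<longleftrightarrow>
     (\<forall>k. \<xi> k \<in> carrier_vec (dim_row A) \<and> u k \<in> carrier_vec (dim_col B) \<and>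
          \<xi> (Suc k) = A *\<^sub>v \<xi> k + B *\<^sub>v u k \<and> y k = C *\<^sub>v \<xi> k)"

text \<open>The stacked vector \<open>(y (k + r - 1), \<dots>, y k)\<close>, newest output first, for outputs of dimension \<open>d\<close>.\<close>

definition output_stack :: "nat \<Rightarrow> nat \<Rightarrow> (nat \<Rightarrow> real vec) \<Rightarrow> nat \<Rightarrow> real vec" where
  "output_stack r d y k = vec (r * d) (\<lambda>i. y (k + r - 1 - i div d) $ (i mod d))"

text \<open>The \<open>p \<times> q\<close> block matrix whose \<open>(i, j)\<close> block, counted from 0, is the \<open>d \<times> d\<close> matrix \<open>F i j\<close>.\<close>

definition block_mat :: "nat \<Rightarrow> nat \<Rightarrow> nat \<Rightarrow> (nat \<Rightarrow> nat \<Rightarrow> real mat) \<Rightarrow> real mat" where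
  "block_mat d p q F = mat (p * d) (q * d) (\<lambda>(i, j). F (i div d) (j div d) $$ (i mod d, j mod d))"

definition append_cols :: "real mat \<Rightarrow> real mat \<Rightarrow> real mat" (infixr \<open>@\<^sub>c\<close> 65) where
  "M @\<^sub>c N = (M\<^sup>T @\<^sub>r N\<^sup>T)\<^sup>T"

end

theory Submission
  imports Defs "Jordan_Normal_Form.Determinant"
begin

text \<open>
  Write \<open>A = a \<otimes> I\<close>, \<open>B = b \<otimes> I\<close> and \<open>C = c \<otimes> I\<close>. Tensoring with \<open>I\<close> is multiplicative, so the
  claim is a statement about the single-input single-output system \<open>(a, b, c)\<close>: a change of basis
  \<open>t\<close> for it gives the change of basis \<open>t \<otimes> I\<close> for the given system. As the Markov parameters
  \<open>C A\<^sup>s B\<close> equal \<open>(c a\<^sup>s b) \<otimes> I\<close>, both systems have relative degree \<open>r\<close>.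

  The first \<open>r\<close> rows of \<open>t\<close> have to be \<open>c a\<^sup>r\<^sup>-\<^sup>1, \<dots>, c a, c\<close>. Since an input needs \<open>r\<close> steps to
  reach the output, these rows map the state to \<open>(y (k + r - 1), \<dots>, y k)\<close>
  (\<open>output_before_relative_degree\<close>). Multiplying all but the first of them by \<open>a\<close> from the right
  gives the row above, hence the shift structure of \<open>A11\<close> and \<open>A12\<close>
  (\<open>observability_shift\<close>), and \<open>c\<close> is itself a row of \<open>t\<close>, hence the shape of \<open>Ct\<close>
  (\<open>output_reads_last_row\<close>).

  What remains is to choose the other \<open>n - r\<close> rows so that \<open>t\<close> is invertible and these rows
  annihilate \<open>b\<close>, which is the zero block of \<open>Bt\<close> (\<open>relative_degree_basis\<close>). The rows
  \<open>c a\<^sup>r\<^sup>-\<^sup>1\<^sup>-\<^sup>i\<close> paired with the columns \<open>a\<^sup>j b\<close>, for \<open>i\<close> and \<open>j\<close> below \<open>r\<close>, form a matrix of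
  Markov parameters that vanishes below the diagonal and has \<open>c a\<^sup>r\<^sup>-\<^sup>1 b \<noteq> 0\<close> on it. It is
  therefore invertible, and after a change of basis of the columns the two families are
  biorthogonal. Biorthogonal families can be completed to a pair of dual bases
  (\<open>right_inverse_complete\<close>). The new rows are orthogonal to all the given columns, in particular to
  \<open>b\<close>. The same biorthogonality forces \<open>r \<le> n\<close>.
\<close>

section \<open>Kronecker products with an identity matrix\<close>

lemma kron_dim [simp]:
  "dim_row (X \<otimes>\<^sub>k Y) = dim_row X * dim_row Y"
  "dim_col (X \<otimes>\<^sub>k Y) = dim_col X * dim_col Y"
  by (auto simp: kron_def)

lemma kron_index:
  assumes "i < dim_row X * dim_row Y" "j < dim_col X * dim_col Y"
  shows "(X \<otimes>\<^sub>k Y) $$ (i, j)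
    = X $$ (i div dim_row Y, j div dim_col Y) * Y $$ (i mod dim_row Y, j mod dim_col Y)"
  using assms by (simp add: kron_def)

lemma block_pos:
  fixes i d m :: nat
  assumes "i < m * d"
  shows "0 < d" "i div d < m" "i mod d < d"
proof -
  show d: "0 < d" using assms by (cases d) auto
  show "i div d < m" using assms by (rule less_mult_imp_div_less)
  show "i mod d < d" using d by simp
qed

text \<open>
  An index below \<open>m * d\<close> is a block number below \<open>m\<close> together with a position below \<open>d\<close> inside the
  block; sums over matrix indices split accordingly. This is what makes the Kronecker product
  multiplicative.
\<close>

lemma sum_blocks:
  fixes f :: "nat \<Rightarrow> 'a :: comm_monoid_add"
  assumes "0 < d"
  shows "(\<Sum>k<m * d. f k) = (\<Sum>x<m. \<Sum>l<d. f (x * d + l))"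
proof -
  have "(\<Sum>k<m * d. f k) = (\<Sum>x<m. sum f {x * d..<x * d + d})"
    by (rule sum.nat_group [symmetric])
  also have "\<dots> = (\<Sum>x<m. \<Sum>l<d. f (x * d + l))"
  proof (rule sum.cong [OF refl])
    show "sum f {x * d..<x * d + d} = (\<Sum>l<d. f (x * d + l))" for x
      using sum.shift_bounds_nat_ivl[of f 0 "x * d" d]
      by (simp add: add.commute atLeast0LessThan)
  qed
  finally show ?thesis .
qed

lemma kron_mult:
  assumes "X \<in> carrier_mat m p" "Z \<in> carrier_mat p q"
    and "Y \<in> carrier_mat e f" "W \<in> carrier_mat f g"
  shows "(X \<otimes>\<^sub>k Y) * (Z \<otimes>\<^sub>k W) = (X * Z) \<otimes>\<^sub>k (Y * W)"
proof (rule eq_matI)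
  fix i j
  assume "i < dim_row ((X * Z) \<otimes>\<^sub>k (Y * W))" "j < dim_col ((X * Z) \<otimes>\<^sub>k (Y * W))"
  with assms have ij: "i < m * e" "j < q * g" by auto
  note b = block_pos[OF ij(1)] block_pos[OF ij(2)]
  let ?x = "i div e" and ?y = "i mod e" and ?z = "j div g" and ?w = "j mod g"
  have "((X \<otimes>\<^sub>k Y) * (Z \<otimes>\<^sub>k W)) $$ (i, j)
    = (\<Sum>k<p * f. (X $$ (?x, k div f) * Y $$ (?y, k mod f)) * (Z $$ (k div f, ?z) * W $$ (k mod f, ?w)))"
    using assms ij
    by (simp add: scalar_prod_def kron_index atLeast0LessThan)
  also have "\<dots> = (\<Sum>k<p. \<Sum>l<f. (X $$ (?x, k) * Z $$ (k, ?z)) * (Y $$ (?y, l) * W $$ (l, ?w)))"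
  proof (cases "f = 0")
    case False
    then show ?thesis by (subst sum_blocks) (auto intro!: sum.cong)
  qed simp
  also have "\<dots> = (\<Sum>k<p. X $$ (?x, k) * Z $$ (k, ?z)) * (\<Sum>l<f. Y $$ (?y, l) * W $$ (l, ?w))"
    by (simp add: sum_product)
  also have "\<dots> = ((X * Z) \<otimes>\<^sub>k (Y * W)) $$ (i, j)"
    using assms ij b
    by (simp add: scalar_prod_def kron_index atLeast0LessThan)
  finally show "((X \<otimes>\<^sub>k Y) * (Z \<otimes>\<^sub>k W)) $$ (i, j) = ((X * Z) \<otimes>\<^sub>k (Y * W)) $$ (i, j)" .
qed (use assms in auto)

lemma kron_one_one: "1\<^sub>m n \<otimes>\<^sub>k 1\<^sub>m d = 1\<^sub>m (n * d)"
proof (rule eq_matI)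
  fix i j
  assume "i < dim_row (1\<^sub>m (n * d) :: real mat)" "j < dim_col (1\<^sub>m (n * d) :: real mat)"
  then have ij: "i < n * d" "j < n * d" by auto
  have "i = j \<longleftrightarrow> i div d = j div d \<and> i mod d = j mod d"
    by (metis div_mult_mod_eq)
  then show "(1\<^sub>m n \<otimes>\<^sub>k 1\<^sub>m d) $$ (i, j) = 1\<^sub>m (n * d) $$ (i, j)"
    using ij block_pos[OF ij(1)] block_pos[OF ij(2)] by (auto simp: kron_index)
qed auto

lemma kron_one_mult:
  assumes "X \<in> carrier_mat m p" "Z \<in> carrier_mat p q"
  shows "(X \<otimes>\<^sub>k 1\<^sub>m d) * (Z \<otimes>\<^sub>k 1\<^sub>m d) = (X * Z) \<otimes>\<^sub>k 1\<^sub>m d"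
  using kron_mult[OF assms, of "1\<^sub>m d" d d "1\<^sub>m d" d] by simp

lemma kron_one_pow:
  assumes "X \<in> carrier_mat n n"
  shows "(X \<otimes>\<^sub>k 1\<^sub>m d) ^\<^sub>m p = (X ^\<^sub>m p) \<otimes>\<^sub>k 1\<^sub>m d"
proof (induction p)
  case 0
  then show ?case using assms by (simp add: kron_one_one)
next
  case (Suc p)
  then show ?case using assms kron_one_mult[of "X ^\<^sub>m p" n n X n d] by simp
qed

lemma kron_one_index:
  assumes "i < dim_row X * d" "j < dim_col X * d"
  shows "(X \<otimes>\<^sub>k 1\<^sub>m d) $$ (i, j) = (if i mod d = j mod d then X $$ (i div d, j div d) else 0)"
  using assms block_pos[OF assms(1)] block_pos[OF assms(2)] by (simp add: kron_index)

lemma kronecker_formE: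
  assumes "kronecker_form d M" "M \<in> carrier_mat (m * d) (p * d)" "0 < d"
  obtains X where "X \<in> carrier_mat m p" "M = X \<otimes>\<^sub>k 1\<^sub>m d"
proof -
  obtain X where X: "M = X \<otimes>\<^sub>k 1\<^sub>m d" using assms(1) by (auto simp: kronecker_form_def)
  have "dim_row X * d = m * d" "dim_col X * d = p * d"
    using assms(2) kron_dim[of X "1\<^sub>m d"] unfolding X carrier_mat_def by simp_all
  then have "X \<in> carrier_mat m p" using assms(3) by (intro carrier_matI) simp_all
  from this X show thesis by (rule that)
qed

lemma kron_one_eq_0_iff:
  assumes "X \<in> carrier_mat 1 1" "0 < d"
  shows "X \<otimes>\<^sub>k 1\<^sub>m d = 0\<^sub>m d d \<longleftrightarrow> X $$ (0, 0) = 0"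
proof
  assume "X \<otimes>\<^sub>k 1\<^sub>m d = 0\<^sub>m d d"
  then have "(X \<otimes>\<^sub>k 1\<^sub>m d) $$ (0, 0) = 0" using assms by simp
  then show "X $$ (0, 0) = 0" using assms by (simp add: kron_one_index)
next
  assume "X $$ (0, 0) = 0"
  then show "X \<otimes>\<^sub>k 1\<^sub>m d = 0\<^sub>m d d"
    using assms by (intro eq_matI) (auto simp: kron_one_index)
qed

section \<open>Completing biorthogonal families to dual bases\<close>

text \<open>
  Padding with zeros makes both factors square, where a right inverse is also a left inverse; but a
  product whose first factor has a zero row is not the identity.
\<close>

lemma right_inverse_dim_le:
  fixes M N :: "'a :: field mat"
  assumes M: "M \<in> carrier_mat r n" and N: "N \<in> carrier_mat n r" and MN: "M * N = 1\<^sub>m r"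
  shows "r \<le> n"
proof (rule ccontr)
  assume "\<not> r \<le> n"
  then have nr: "n < r" by simp
  define M' where "M' = mat r r (\<lambda>(i, k). if k < n then M $$ (i, k) else 0)"
  define N' where "N' = mat r r (\<lambda>(k, j). if k < n then N $$ (k, j) else 0)"
  have c: "M' \<in> carrier_mat r r" "N' \<in> carrier_mat r r" by (auto simp: M'_def N'_def)
  have "M' * N' = M * N"
  proof (rule eq_matI)
    fix i j
    assume "i < dim_row (M * N)" "j < dim_col (M * N)"
    then have ij: "i < r" "j < r" using M N by auto
    have "(\<Sum>k\<in>{0..<r}. (if k < n then M $$ (i, k) else 0) * (if k < n then N $$ (k, j) else 0))
      = (\<Sum>k\<in>{0..<n}. M $$ (i, k) * N $$ (k, j))"
      using nr by (intro sum.mono_neutral_cong_right) auto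
    then show "(M' * N') $$ (i, j) = (M * N) $$ (i, j)"
      using ij M N nr by (simp add: M'_def N'_def scalar_prod_def)
  qed (use M N in \<open>auto simp: M'_def N'_def\<close>)
  with MN have "N' * M' = 1\<^sub>m r" using mat_mult_left_right_inverse[OF c] by simp
  then have "(N' * M') $$ (n, n) = 1" using nr by simp
  moreover have "(N' * M') $$ (n, n) = 0"
    using nr by (simp add: N'_def M'_def scalar_prod_def)
  ultimately show False by simp
qed

text \<open>
  The columns of \<open>N\<close> and the rows of \<open>M\<close> are biorthogonal families, and \<open>P = 1 - N M\<close> is the
  projector onto the kernel of \<open>M\<close> along the range of \<open>N\<close>. Its trace is \<open>n - r\<close>, so for
  \<open>r < n\<close> it has a nonzero entry \<open>(p, q)\<close> (here characteristic 0 enters). Row \<open>p\<close> of \<open>P\<close> then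
  annihilates \<open>N\<close>, column \<open>q\<close> is annihilated by \<open>M\<close>, and their product is the \<open>(p, q)\<close> entry of
  \<open>P\<^sup>2 = P\<close>, so that dividing by it extends both families by one vector.
\<close>

lemma right_inverse_extend:
  fixes M N :: "'a :: field_char_0 mat"
  assumes M: "M \<in> carrier_mat r n" and N: "N \<in> carrier_mat n r" and MN: "M * N = 1\<^sub>m r"
    and rn: "r < n"
  shows "\<exists>M' N'. M' \<in> carrier_mat (Suc r) n \<and> N' \<in> carrier_mat n (Suc r) \<and> M' * N' = 1\<^sub>m (Suc r) \<and>
    (\<forall>i<r. \<forall>k<n. M' $$ (i, k) = M $$ (i, k) \<and> N' $$ (k, i) = N $$ (k, i))"
proof -
  define P where "P = 1\<^sub>m n - N * M"
  have P: "P \<in> carrier_mat n n" using M N by (auto simp: P_def)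
  have NM: "N * M \<in> carrier_mat n n" using M N by auto
  have "M * (N * M) = M" using M N MN by (simp flip: assoc_mult_mat[OF M N M])
  then have MP: "M * P = 0\<^sub>m r n"
    unfolding P_def using M N NM by (subst mult_minus_distrib_mat[OF M _ NM]) auto
  have "(N * M) * N = N" using M N MN by (simp add: assoc_mult_mat[OF N M N])
  then have PN: "P * N = 0\<^sub>m n r"
    unfolding P_def using M N NM by (subst minus_mult_distrib_mat[OF _ NM N]) auto
  have PP: "P * P = P"
  proof -
    have "P * P = P * 1\<^sub>m n - P * (N * M)"
      by (subst (2) P_def) (use P NM in \<open>simp add: mult_minus_distrib_mat[OF P _ NM]\<close>)
    also have "P * (N * M) = 0\<^sub>m n n" using PN M by (simp flip: assoc_mult_mat[OF P N M])
    finally show ?thesis using P by auto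
  qed
  have "\<exists>p<n. \<exists>q<n. P $$ (p, q) \<noteq> 0"
  proof (rule ccontr)
    assume "\<not> ?thesis"
    then have z: "P $$ (k, k) = 0" if "k < n" for k using that by blast
    have "(of_nat n :: 'a) = (\<Sum>k<n. (N * M) $$ (k, k))"
    proof -
      have "(N * M) $$ (k, k) = 1" if "k < n" for k
        using z[OF that] that M N unfolding P_def by simp
      then show ?thesis by simp
    qed
    also have "\<dots> = (\<Sum>k<n. \<Sum>i<r. N $$ (k, i) * M $$ (i, k))"
      using M N by (simp add: scalar_prod_def atLeast0LessThan)
    also have "\<dots> = (\<Sum>i<r. \<Sum>k<n. M $$ (i, k) * N $$ (k, i))"
      by (subst sum.swap) (simp add: mult.commute)
    also have "\<dots> = (\<Sum>i<r. (M * N) $$ (i, i))"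
      using M N by (simp add: scalar_prod_def atLeast0LessThan)
    also have "\<dots> = of_nat r" using MN by simp
    finally show False using rn by simp
  qed
  then obtain p q where pq: "p < n" "q < n" "P $$ (p, q) \<noteq> 0" by blast
  define M' where "M' = mat (Suc r) n (\<lambda>(i, k). if i < r then M $$ (i, k) else P $$ (p, k))"
  define N' where "N' = mat n (Suc r)
    (\<lambda>(k, j). if j < r then N $$ (k, j) else P $$ (k, q) / P $$ (p, q))"
  have "M' * N' = 1\<^sub>m (Suc r)"
  proof (rule eq_matI)
    fix i j
    assume "i < dim_row (1\<^sub>m (Suc r) :: 'a mat)" "j < dim_col (1\<^sub>m (Suc r) :: 'a mat)"
    then have ij: "i < Suc r" "j < Suc r" by auto
    have e1: "(\<Sum>k<n. M $$ (i, k) * N $$ (k, j)) = (if i = j then 1 else 0)" if "i < r" "j < r"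
      using arg_cong[OF MN, of "\<lambda>X. X $$ (i, j)"] that M N
      by (simp add: scalar_prod_def atLeast0LessThan)
    have e2: "(\<Sum>k<n. M $$ (i, k) * P $$ (k, q)) = 0" if "i < r"
      using arg_cong[OF MP, of "\<lambda>X. X $$ (i, q)"] that pq M P
      by (simp add: scalar_prod_def atLeast0LessThan)
    have e3: "(\<Sum>k<n. P $$ (p, k) * N $$ (k, j)) = 0" if "j < r"
      using arg_cong[OF PN, of "\<lambda>X. X $$ (p, j)"] that pq N P
      by (simp add: scalar_prod_def atLeast0LessThan)
    have e4: "(\<Sum>k<n. P $$ (p, k) * P $$ (k, q)) = P $$ (p, q)"
      using arg_cong[OF PP, of "\<lambda>X. X $$ (p, q)"] pq P
      by (simp add: scalar_prod_def atLeast0LessThan)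
    have "(M' * N') $$ (i, j) = (\<Sum>k<n. M' $$ (i, k) * N' $$ (k, j))"
      using ij by (simp add: M'_def N'_def scalar_prod_def atLeast0LessThan)
    also have "\<dots> = (if i = j then 1 else 0)"
      using ij e1 e2 e3 e4 pq
      by (auto simp: M'_def N'_def less_Suc_eq simp flip: sum_divide_distrib)
    finally show "(M' * N') $$ (i, j) = 1\<^sub>m (Suc r) $$ (i, j)" using ij by simp
  qed (auto simp: M'_def N'_def)
  then show ?thesis
    by (intro exI[of _ M'] exI[of _ N']) (auto simp: M'_def N'_def)
qed

text \<open>
  Prescribing the first columns of \<open>Tinv\<close> along with the first rows of \<open>T\<close> is the point: it makes
  the remaining rows of \<open>T\<close> annihilate \<open>N\<close>.
\<close>

lemma right_inverse_complete:
  fixes M N :: "'a :: field_char_0 mat"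
  assumes "M \<in> carrier_mat r n" "N \<in> carrier_mat n r" "M * N = 1\<^sub>m r"
  shows "\<exists>T Tinv. T \<in> carrier_mat n n \<and> Tinv \<in> carrier_mat n n \<and>
    T * Tinv = 1\<^sub>m n \<and> Tinv * T = 1\<^sub>m n \<and>
    (\<forall>i<r. \<forall>k<n. T $$ (i, k) = M $$ (i, k) \<and> Tinv $$ (k, i) = N $$ (k, i))"
proof -
  have "r \<le> n" by (rule right_inverse_dim_le[OF assms])
  then show ?thesis
    using assms
  proof (induction r arbitrary: M N rule: inc_induct)
    case base
    from base mat_mult_left_right_inverse[OF base] show ?case
      by (intro exI[of _ M] exI[of _ N]) simp
  next
    case (step r)
    obtain M' N' where *: "M' \<in> carrier_mat (Suc r) n" "N' \<in> carrier_mat n (Suc r)"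
        "M' * N' = 1\<^sub>m (Suc r)"
      and e: "\<forall>i<r. \<forall>k<n. M' $$ (i, k) = M $$ (i, k) \<and> N' $$ (k, i) = N $$ (k, i)"
      using right_inverse_extend[OF step.prems step.hyps(2)] by blast
    obtain T Tinv where T: "T \<in> carrier_mat n n" "Tinv \<in> carrier_mat n n"
        "T * Tinv = 1\<^sub>m n" "Tinv * T = 1\<^sub>m n"
      and e': "\<forall>i<Suc r. \<forall>k<n. T $$ (i, k) = M' $$ (i, k) \<and> Tinv $$ (k, i) = N' $$ (k, i)"
      using step.IH[OF *] by (elim exE conjE)
    from T e e' show ?case by (intro exI[of _ T] exI[of _ Tinv]) simp
  qed
qed

section \<open>A basis adapted to the relative degree of a scalar system\<close>

lemma pow_mat_plus:
  fixes A :: "'a :: semiring_1 mat"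
  assumes "A \<in> carrier_mat n n"
  shows "A ^\<^sub>m (i + j) = A ^\<^sub>m i * A ^\<^sub>m j"
proof (induction j)
  case (Suc j)
  then show ?case using assms by (simp add: assoc_mult_mat[of _ n n _ n _ n])
qed (use assms in auto)

text \<open>
  The matrix \<open>H\<close> below has the entries \<open>c a\<^sup>r\<^sup>-\<^sup>1\<^sup>-\<^sup>i\<^sup>+\<^sup>j b\<close>. They vanish for \<open>j < i\<close> and are nonzero
  for \<open>i = j\<close>, so \<open>H\<close> is invertible and \<open>M\<close> has the right inverse \<open>N = K H\<^sup>-\<^sup>1\<close>. Completing
  these to \<open>t\<close> and its inverse turns \<open>t N\<close> into the first \<open>r\<close> columns of the identity. Hence
  \<open>t b\<close>, the first column of \<open>t K = t N H\<close>, is the first column of \<open>H\<close> padded with zeros.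
\<close>

lemma relative_degree_basis:
  fixes a b c :: "'a :: field_char_0 mat"
  assumes a: "a \<in> carrier_mat n n" and b: "b \<in> carrier_mat n 1" and c: "c \<in> carrier_mat 1 n"
    and r: "1 \<le> r"
    and zero: "\<forall>s. Suc s < r \<longrightarrow> (c * a ^\<^sub>m s * b) $$ (0, 0) = 0"
    and nz: "(c * a ^\<^sub>m (r - 1) * b) $$ (0, 0) \<noteq> 0"
  obtains t tinv where "r \<le> n" "t \<in> carrier_mat n n" "tinv \<in> carrier_mat n n"
    "t * tinv = 1\<^sub>m n" "tinv * t = 1\<^sub>m n"
    "\<forall>i<r. \<forall>k<n. t $$ (i, k) = (c * a ^\<^sub>m (r - 1 - i)) $$ (0, k)"
    "\<forall>i<n. (t * b) $$ (i, 0) = (if i = 0 then (c * a ^\<^sub>m (r - 1) * b) $$ (0, 0) else 0)"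
proof -
  define M where "M = mat r n (\<lambda>(i, k). (c * a ^\<^sub>m (r - 1 - i)) $$ (0, k))"
  define K where "K = mat n r (\<lambda>(k, j). (a ^\<^sub>m j * b) $$ (k, 0))"
  define H where "H = M * K"
  have M: "M \<in> carrier_mat r n" and K: "K \<in> carrier_mat n r" and H: "H \<in> carrier_mat r r"
    by (auto simp: M_def K_def H_def)
  have ap: "a ^\<^sub>m i \<in> carrier_mat n n" for i using a by simp
  have H_index: "H $$ (i, j) = (c * a ^\<^sub>m (r - 1 - i + j) * b) $$ (0, 0)" if "i < r" "j < r" for i j
  proof -
    have "H $$ (i, j) = ((c * a ^\<^sub>m (r - 1 - i)) * (a ^\<^sub>m j * b)) $$ (0, 0)"
      using that a b c by (simp add: H_def M_def K_def scalar_prod_def)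
    also have "(c * a ^\<^sub>m (r - 1 - i)) * (a ^\<^sub>m j * b) = c * (a ^\<^sub>m (r - 1 - i) * (a ^\<^sub>m j * b))"
      by (rule assoc_mult_mat[OF c ap mult_carrier_mat[OF ap b]])
    also have "a ^\<^sub>m (r - 1 - i) * (a ^\<^sub>m j * b) = a ^\<^sub>m (r - 1 - i + j) * b"
      unfolding pow_mat_plus[OF a] by (rule assoc_mult_mat[OF ap ap b, symmetric])
    also have "c * (a ^\<^sub>m (r - 1 - i + j) * b) = c * a ^\<^sub>m (r - 1 - i + j) * b"
      by (rule assoc_mult_mat[OF c ap b, symmetric])
    finally show ?thesis .
  qed
  have "upper_triangular H"
    unfolding upper_triangular_def using H by (auto simp: H_index intro!: zero[rule_format])
  then have "det H = prod_list (diag_mat H)" using H by (rule det_upper_triangular)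
  moreover have "diag_mat H = map (\<lambda>i. (c * a ^\<^sub>m (r - 1) * b) $$ (0, 0)) [0..<r]"
    using H by (auto simp: diag_mat_def H_index)
  ultimately have "det H \<noteq> 0" using nz by (auto simp: prod_list_zero_iff)
  then have "H \<in> Units (ring_mat TYPE('a) r undefined)" by (rule det_non_zero_imp_unit[OF H])
  then obtain G where G: "G \<in> carrier_mat r r" "H * G = 1\<^sub>m r" "G * H = 1\<^sub>m r"
    by (auto simp: Units_def ring_mat_def)
  define N where "N = K * G"
  have N: "N \<in> carrier_mat n r" using K G by (auto simp: N_def)
  have MN: "M * N = 1\<^sub>m r"
    unfolding N_def using G by (simp add: H_def flip: assoc_mult_mat[OF M K G(1)])
  have "N * H = K * (G * H)" unfolding N_def by (rule assoc_mult_mat[OF K G(1) H])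
  then have NH: "N * H = K" using K G by simp
  obtain t tinv where t: "t \<in> carrier_mat n n" "tinv \<in> carrier_mat n n"
    "t * tinv = 1\<^sub>m n" "tinv * t = 1\<^sub>m n"
    and e: "\<forall>i<r. \<forall>k<n. t $$ (i, k) = M $$ (i, k) \<and> tinv $$ (k, i) = N $$ (k, i)"
    using right_inverse_complete[OF M N MN] by blast
  have rn: "r \<le> n" by (rule right_inverse_dim_le[OF M N MN])
  have tN: "(t * N) $$ (i, j) = (if i = j then 1 else 0)" if "i < n" "j < r" for i j
  proof -
    have "(t * N) $$ (i, j) = (t * tinv) $$ (i, j)"
      using that rn t(1,2) N e by (simp add: scalar_prod_def)
    then show ?thesis using t(3) that rn by simp
  qed
  have "(t * b) $$ (i, 0) = (if i = 0 then (c * a ^\<^sub>m (r - 1) * b) $$ (0, 0) else 0)" if i: "i < n" for i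
  proof -
    have "(t * b) $$ (i, 0) = (t * K) $$ (i, 0)"
      using i r t(1) b a by (simp add: K_def scalar_prod_def)
    also have "t * K = (t * N) * H" by (simp add: NH assoc_mult_mat[OF t(1) N H])
    also have "\<dots> $$ (i, 0) = (\<Sum>k<r. (t * N) $$ (i, k) * H $$ (k, 0))"
      using i r t(1) N H by (simp add: scalar_prod_def atLeast0LessThan del: assoc_mult_mat)
    also have "\<dots> = (\<Sum>k<r. if k = i then H $$ (k, 0) else 0)"
      using i by (intro sum.cong refl) (simp add: tN)
    also have "\<dots> = (if i < r then H $$ (i, 0) else 0)" by simp
    also have "\<dots> = (if i = 0 then (c * a ^\<^sub>m (r - 1) * b) $$ (0, 0) else 0)"
      using r by (auto simp: H_index intro!: zero[rule_format])
    finally show ?thesis .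
  qed
  then have tb: "\<forall>i<n. (t * b) $$ (i, 0)
      = (if i = 0 then (c * a ^\<^sub>m (r - 1) * b) $$ (0, 0) else 0)"
    by blast
  have rows: "\<forall>i<r. \<forall>k<n. t $$ (i, k) = (c * a ^\<^sub>m (r - 1 - i)) $$ (0, k)"
    using e by (simp add: M_def)
  show thesis by (rule that[OF rn t rows tb])
qed

text \<open>
  The part of the normal form that comes from the rows \<open>c a\<^sup>r\<^sup>-\<^sup>1\<^sup>-\<^sup>i\<close> of \<open>t\<close> alone, whatever its
  other rows are.
\<close>

context
  fixes a c t tinv :: "'a :: semiring_1 mat" and n r :: nat
  assumes a: "a \<in> carrier_mat n n" and c: "c \<in> carrier_mat 1 n" and r: "1 \<le> r" "r \<le> n"
    and t: "t \<in> carrier_mat n n" and tinv: "tinv \<in> carrier_mat n n" and inv: "t * tinv = 1\<^sub>m n"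
    and rows: "\<forall>i<r. \<forall>k<n. t $$ (i, k) = (c * a ^\<^sub>m (r - 1 - i)) $$ (0, k)"
begin

lemma row_times_inverse:
  assumes "i < n" "j < n"
  shows "(\<Sum>l<n. t $$ (i, l) * tinv $$ (l, j)) = (if i = j then 1 else 0)"
  using arg_cong[OF inv, of "\<lambda>X. X $$ (i, j)"] assms t tinv
  by (simp add: scalar_prod_def atLeast0LessThan)

text \<open>
  Row \<open>i + 1\<close> of \<open>t a\<close> is row \<open>i\<close> of \<open>t\<close>, and row \<open>i\<close> of \<open>t tinv\<close> is a unit vector.
\<close>

lemma observability_shift:
  assumes i: "Suc i < r" and j: "j < n"
  shows "(t * a * tinv) $$ (Suc i, j) = (if i = j then 1 else 0)"
proof -
  have ta: "(t * a) $$ (Suc i, k) = t $$ (i, k)" if k: "k < n" for k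
  proof -
    have p: "Suc (r - 1 - Suc i) = r - 1 - i" using i by simp
    have "(t * a) $$ (Suc i, k) = (\<Sum>l<n. (c * a ^\<^sub>m (r - 1 - Suc i)) $$ (0, l) * a $$ (l, k))"
      using i k r t a rows by (simp add: scalar_prod_def atLeast0LessThan)
    also have "\<dots> = ((c * a ^\<^sub>m (r - 1 - Suc i)) * a) $$ (0, k)"
      using a c k by (simp add: scalar_prod_def atLeast0LessThan del: assoc_mult_mat)
    also have "(c * a ^\<^sub>m (r - 1 - Suc i)) * a = c * a ^\<^sub>m Suc (r - 1 - Suc i)"
      using assoc_mult_mat[OF c pow_carrier_mat[OF a] a] by simp
    also have "\<dots> $$ (0, k) = t $$ (i, k)"
      unfolding p using rows i k by simp
    finally show ?thesis .
  qed
  have "(t * a * tinv) $$ (Suc i, j) = (\<Sum>l<n. (t * a) $$ (Suc i, l) * tinv $$ (l, j))"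
    using i j r t a tinv by (simp add: scalar_prod_def atLeast0LessThan del: assoc_mult_mat)
  also have "\<dots> = (\<Sum>l<n. t $$ (i, l) * tinv $$ (l, j))"
    by (intro sum.cong refl) (simp add: ta)
  finally show ?thesis using row_times_inverse[of i j] i j r by simp
qed

lemma output_reads_last_row:
  assumes j: "j < n"
  shows "(c * tinv) $$ (0, j) = (if j = r - 1 then 1 else 0)"
proof -
  have last: "t $$ (r - 1, l) = c $$ (0, l)" if "l < n" for l
  proof -
    have "t $$ (r - 1, l) = (c * 1\<^sub>m n) $$ (0, l)" using rows r that a by simp
    then show ?thesis unfolding right_mult_one_mat[OF c] .
  qed
  have "(c * tinv) $$ (0, j) = (\<Sum>l<n. c $$ (0, l) * tinv $$ (l, j))"
    using j c tinv by (simp add: scalar_prod_def atLeast0LessThan)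
  also have "\<dots> = (\<Sum>l<n. t $$ (r - 1, l) * tinv $$ (l, j))"
    by (rule sum.cong[OF refl]) (simp only: last lessThan_iff)
  finally have "(c * tinv) $$ (0, j) = (\<Sum>l<n. t $$ (r - 1, l) * tinv $$ (l, j))" .
  then show ?thesis using row_times_inverse[of "r - 1" j] j r by auto
qed

end

section \<open>Entries of block matrices\<close>

lemma block_mat_carrier [simp]: "block_mat d p q F \<in> carrier_mat (p * d) (q * d)"
  by (simp add: block_mat_def)

lemma block_mat_index:
  "i < p * d \<Longrightarrow> j < q * d \<Longrightarrow>
    block_mat d p q F $$ (i, j) = F (i div d) (j div d) $$ (i mod d, j mod d)"
  by (simp add: block_mat_def)

lemma append_rows_index:
  assumes "P \<in> carrier_mat m q" "Q \<in> carrier_mat l q" "i < m + l" "j < q"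
  shows "(P @\<^sub>r Q) $$ (i, j) = (if i < m then P $$ (i, j) else Q $$ (i - m, j))"
  using assms by (auto simp: append_rows_def)

lemma append_cols_carrier [simp]:
  assumes "P \<in> carrier_mat q m" "Q \<in> carrier_mat q l"
  shows "P @\<^sub>c Q \<in> carrier_mat q (m + l)"
  using assms by (simp add: append_cols_def)

lemma append_cols_index:
  assumes "P \<in> carrier_mat q m" "Q \<in> carrier_mat q l" "i < q" "j < m + l"
  shows "(P @\<^sub>c Q) $$ (i, j) = (if j < m then P $$ (i, j) else Q $$ (i, j - m))"
proof -
  have "P\<^sup>T @\<^sub>r Q\<^sup>T \<in> carrier_mat (m + l) q" using assms by auto
  then have "(P @\<^sub>c Q) $$ (i, j) = (P\<^sup>T @\<^sub>r Q\<^sup>T) $$ (j, i)"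
    using assms by (simp add: append_cols_def append_rows_def)
  also have "\<dots> = (if j < m then P\<^sup>T $$ (j, i) else Q\<^sup>T $$ (j - m, i))"
    using assms by (intro append_rows_index) auto
  finally show ?thesis using assms by auto
qed

section \<open>Outputs below the relative degree\<close>

text \<open>
  Moving one factor \<open>A\<close> at a time from the power to the state,
  \<open>C A\<^sup>q \<xi> (k + p + 1) = C A\<^sup>q\<^sup>+\<^sup>1 \<xi> (k + p) + C A\<^sup>q B u (k + p)\<close>, and the input term is zero as
  long as \<open>q + 1 < r\<close>.
\<close>

lemma output_before_relative_degree:
  assumes A: "A \<in> carrier_mat N N" and B: "B \<in> carrier_mat N m" and C: "C \<in> carrier_mat l N"
    and deg: "has_relative_degree A B C r" and traj: "lti_trajectory A B C \<xi> u y"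
    and "p < r"
  shows "y (k + p) = (C * A ^\<^sub>m p) *\<^sub>v \<xi> k"
proof -
  have \<xi>: "\<xi> k \<in> carrier_vec N" and u: "u k \<in> carrier_vec m"
    and step: "\<xi> (Suc k) = A *\<^sub>v \<xi> k + B *\<^sub>v u k" and out: "y k = C *\<^sub>v \<xi> k" for k
    using traj A B by (auto simp: lti_trajectory_def)
  have ap: "A ^\<^sub>m q \<in> carrier_mat N N" for q using A by simp
  have cap: "C * A ^\<^sub>m q \<in> carrier_mat l N" for q using C ap by simp
  have "(C * A ^\<^sub>m q) *\<^sub>v \<xi> (k + p) = (C * A ^\<^sub>m (q + p)) *\<^sub>v \<xi> k" if "q + p < r" for q p
    using that
  proof (induction p arbitrary: q)
    case (Suc p)
    have zero: "C * A ^\<^sub>m q * B = 0\<^sub>m l m"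
    proof -
      have "\<forall>s. 1 \<le> s \<and> s < r \<longrightarrow> C * A ^\<^sub>m (s - 1) * B = 0\<^sub>m (dim_row C) (dim_col B)"
        using deg unfolding has_relative_degree_def by (elim conjE)
      from this[rule_format, of "Suc q"] show ?thesis using Suc.prems B C by simp
    qed
    have "(C * A ^\<^sub>m q) *\<^sub>v \<xi> (k + Suc p)
      = (C * A ^\<^sub>m q) *\<^sub>v (A *\<^sub>v \<xi> (k + p)) + (C * A ^\<^sub>m q) *\<^sub>v (B *\<^sub>v u (k + p))"
      unfolding add_Suc_right step
      by (rule mult_add_distrib_mat_vec[OF cap mult_mat_vec_carrier[OF A \<xi>] mult_mat_vec_carrier[OF B u]])
    also have "(C * A ^\<^sub>m q) *\<^sub>v (B *\<^sub>v u (k + p)) = 0\<^sub>v l"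
      unfolding assoc_mult_mat_vec[OF cap B u, symmetric] zero
      using u[of "k + p"] by (intro eq_vecI) (auto simp: scalar_prod_def)
    also have "(C * A ^\<^sub>m q) *\<^sub>v (A *\<^sub>v \<xi> (k + p)) = (C * A ^\<^sub>m Suc q) *\<^sub>v \<xi> (k + p)"
      using assoc_mult_mat_vec[OF cap A \<xi>, symmetric] assoc_mult_mat[OF C ap A] by simp
    also have "(C * A ^\<^sub>m Suc q) *\<^sub>v \<xi> (k + p) + 0\<^sub>v l = (C * A ^\<^sub>m Suc q) *\<^sub>v \<xi> (k + p)"
      using mult_mat_vec_carrier[OF cap[of "Suc q"] \<xi>] by simp
    also have "\<dots> = (C * A ^\<^sub>m (Suc q + p)) *\<^sub>v \<xi> k" using Suc.prems by (intro Suc.IH) simp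
    finally show ?case by simp
  qed simp
  from this[of 0 p] \<open>p < r\<close> show ?thesis using A C by (simp add: out)
qed

section \<open>The normal form\<close>

theorem theorem1:
  fixes n d r :: nat and A B C :: "real mat"
  assumes "n \<ge> 1" and "d \<ge> 1"
    and "A \<in> carrier_mat (n * d) (n * d)"
    and "B \<in> carrier_mat (n * d) d"
    and "C \<in> carrier_mat d (n * d)"
    and "kronecker_form d A" and "kronecker_form d B" and "kronecker_form d C"
    and "has_relative_degree A B C r"
  shows "r \<le> n \<and>
    (\<exists>T Tinv At Bt Ct A11 A12 A21 A22 B1 C1 (S :: nat \<Rightarrow> real mat) (S' :: nat \<Rightarrow> real mat).
       (\<forall>j < r. S j \<in> carrier_mat d d) \<and>
       (\<forall>j < n - r. S' j \<in> carrier_mat d d) \<and>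
       A11 = block_mat d r r (\<lambda>i j. if i = 0 then S j else if i = j + 1 then 1\<^sub>m d else 0\<^sub>m d d) \<and>
       A12 = block_mat d r (n - r) (\<lambda>i j. if i = 0 then S' j else 0\<^sub>m d d) \<and>
       A21 \<in> carrier_mat ((n - r) * d) (r * d) \<and>
       A22 \<in> carrier_mat ((n - r) * d) ((n - r) * d) \<and>
       B1 = mat_of_cols r [unit_vec r 0] \<otimes>\<^sub>k (C * A ^\<^sub>m (r - 1) * B) \<and>
       C1 = block_mat d 1 r (\<lambda>i j. if j = r - 1 then 1\<^sub>m d else 0\<^sub>m d d) \<and>
       At = four_block_mat A11 A12 A21 A22 \<and>
       Bt = B1 @\<^sub>r 0\<^sub>m ((n - r) * d) d \<and>
       Ct = C1 @\<^sub>c 0\<^sub>m d ((n - r) * d) \<and>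
       similar_mat_wit At A T Tinv \<and> Bt = T * B \<and> Ct = C * Tinv \<and>
       (\<forall>\<xi> u y. lti_trajectory A B C \<xi> u y \<longrightarrow>
          (\<exists>\<xi>2. \<forall>k. \<xi>2 k \<in> carrier_vec ((n - r) * d) \<and>
             T *\<^sub>v \<xi> k = output_stack r d y k @\<^sub>v \<xi>2 k \<and>
             (output_stack r d y (k + 1) @\<^sub>v \<xi>2 (k + 1)) @\<^sub>v y k =
               four_block_mat At Bt Ct (0\<^sub>m d d) *\<^sub>v
                 ((output_stack r d y k @\<^sub>v \<xi>2 k) @\<^sub>v u k))))"
proof -
  have d: "0 < d" using assms(2) by simp
  note A = assms(3) and B = assms(4) and C = assms(5) and deg = assms(9)
  have r: "1 \<le> r" using deg by (simp add: has_relative_degree_def)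
  obtain a where a: "a \<in> carrier_mat n n" and Aa: "A = a \<otimes>\<^sub>k 1\<^sub>m d"
    using kronecker_formE[OF assms(6) A d] by blast
  obtain b where b: "b \<in> carrier_mat n 1" and Bb: "B = b \<otimes>\<^sub>k 1\<^sub>m d"
    using kronecker_formE[OF assms(7), of n 1] B d by auto
  obtain c where c: "c \<in> carrier_mat 1 n" and Cc: "C = c \<otimes>\<^sub>k 1\<^sub>m d"
    using kronecker_formE[OF assms(8), of 1 n] C d by auto
  define h where "h = (c * a ^\<^sub>m (r - 1) * b) $$ (0, 0)"
  have ap: "a ^\<^sub>m s \<in> carrier_mat n n" for s using a by simp
  have cap: "c * a ^\<^sub>m s \<in> carrier_mat 1 n" for s using c ap by simp
  have CA: "C * A ^\<^sub>m s = (c * a ^\<^sub>m s) \<otimes>\<^sub>k 1\<^sub>m d" for s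
    unfolding Aa Cc kron_one_pow[OF a] by (rule kron_one_mult[OF c ap])
  have CAB: "C * A ^\<^sub>m s * B = (c * a ^\<^sub>m s * b) \<otimes>\<^sub>k 1\<^sub>m d" for s
    unfolding CA Bb by (rule kron_one_mult[OF cap b])
  have CAB_zero_iff: "C * A ^\<^sub>m s * B = 0\<^sub>m (dim_row C) (dim_col B) \<longleftrightarrow> (c * a ^\<^sub>m s * b) $$ (0, 0) = 0"
    for s
    unfolding CAB using kron_one_eq_0_iff[OF mult_carrier_mat[OF cap b] d] B C by simp
  have zero: "\<forall>s. Suc s < r \<longrightarrow> (c * a ^\<^sub>m s * b) $$ (0, 0) = 0"
  proof (intro allI impI)
    fix s assume "Suc s < r"
    moreover have "\<forall>s. 1 \<le> s \<and> s < r \<longrightarrow> C * A ^\<^sub>m (s - 1) * B = 0\<^sub>m (dim_row C) (dim_col B)"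
      using deg unfolding has_relative_degree_def by (elim conjE)
    ultimately have "C * A ^\<^sub>m (Suc s - 1) * B = 0\<^sub>m (dim_row C) (dim_col B)" by force
    then show "(c * a ^\<^sub>m s * b) $$ (0, 0) = 0" unfolding CAB_zero_iff by simp
  qed
  have nz: "(c * a ^\<^sub>m (r - 1) * b) $$ (0, 0) \<noteq> 0"
    using deg unfolding has_relative_degree_def CAB_zero_iff by (elim conjE)
  obtain t tinv where rn: "r \<le> n" and t: "t \<in> carrier_mat n n" and tinv: "tinv \<in> carrier_mat n n"
    and inv: "t * tinv = 1\<^sub>m n" "tinv * t = 1\<^sub>m n"
    and rows: "\<forall>i<r. \<forall>k<n. t $$ (i, k) = (c * a ^\<^sub>m (r - 1 - i)) $$ (0, k)"
    and tb: "\<forall>i<n. (t * b) $$ (i, 0) = (if i = 0 then (c * a ^\<^sub>m (r - 1) * b) $$ (0, 0) else 0)"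
    by (rule relative_degree_basis[OF a b c r zero nz])
  note shift = observability_shift[OF a c r rn t tinv inv(1) rows]
  note reads = output_reads_last_row[OF a c r rn t tinv inv(1) rows]
  \<comment> \<open>The scalar data are now lifted to block level. The free blocks of the first block row are
    multiples of \<open>1\<^sub>m d\<close>, and \<open>A21\<close> and \<open>A22\<close> are whatever \<open>At\<close> has there.\<close>
  define a' where "a' = t * a * tinv"
  have a': "a' \<in> carrier_mat n n" using t a tinv by (auto simp: a'_def)

  define T where "T = t \<otimes>\<^sub>k 1\<^sub>m d"
  define Tinv where "Tinv = tinv \<otimes>\<^sub>k 1\<^sub>m d"
  define At where "At = a' \<otimes>\<^sub>k 1\<^sub>m d"
  define Bt where "Bt = (t * b) \<otimes>\<^sub>k 1\<^sub>m d"
  define Ct where "Ct = (c * tinv) \<otimes>\<^sub>k 1\<^sub>m d"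
  define S where "S = (\<lambda>j. a' $$ (0, j) \<cdot>\<^sub>m (1\<^sub>m d :: real mat))"
  define S' where "S' = (\<lambda>j. a' $$ (0, r + j) \<cdot>\<^sub>m (1\<^sub>m d :: real mat))"
  define A11 where "A11 = block_mat d r r
    (\<lambda>i j. if i = 0 then S j else if i = j + 1 then 1\<^sub>m d else 0\<^sub>m d d)"
  define A12 where "A12 = block_mat d r (n - r) (\<lambda>i j. if i = 0 then S' j else 0\<^sub>m d d)"
  define A21 where "A21 = mat ((n - r) * d) (r * d) (\<lambda>(i, j). At $$ (r * d + i, j))"
  define A22 where "A22 = mat ((n - r) * d) ((n - r) * d) (\<lambda>(i, j). At $$ (r * d + i, r * d + j))"
  define B1 where "B1 = mat_of_cols r [unit_vec r 0] \<otimes>\<^sub>k (C * A ^\<^sub>m (r - 1) * B)"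
  define C1 where "C1 = block_mat d 1 r (\<lambda>i j. if j = r - 1 then 1\<^sub>m d else 0\<^sub>m d d)"

  have nd: "n * d = r * d + (n - r) * d" using rn by (simp flip: add_mult_distrib)
  have T: "T \<in> carrier_mat (n * d) (n * d)" and Tinv: "Tinv \<in> carrier_mat (n * d) (n * d)"
    and At: "At \<in> carrier_mat (n * d) (n * d)"
    unfolding T_def Tinv_def At_def using t tinv a' by (auto intro!: carrier_matI)
  have Bt: "Bt \<in> carrier_mat (n * d) d" and Ct: "Ct \<in> carrier_mat d (n * d)"
    unfolding Bt_def Ct_def using t tinv b c by (auto intro!: carrier_matI)
  have B1: "B1 \<in> carrier_mat (r * d) d" using B C unfolding B1_def by (intro carrier_matI) simp_all
  have C1: "C1 \<in> carrier_mat d (r * d)" using block_mat_carrier[of d 1 r] by (simp add: C1_def)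
  have A11: "A11 \<in> carrier_mat (r * d) (r * d)" and A12: "A12 \<in> carrier_mat (r * d) ((n - r) * d)"
    and A21: "A21 \<in> carrier_mat ((n - r) * d) (r * d)"
    and A22: "A22 \<in> carrier_mat ((n - r) * d) ((n - r) * d)"
    by (simp_all add: A11_def A12_def A21_def A22_def)
  have inverses: "T * Tinv = 1\<^sub>m (n * d)" "Tinv * T = 1\<^sub>m (n * d)"
    unfolding T_def Tinv_def kron_one_mult[OF t tinv] kron_one_mult[OF tinv t] inv
    by (rule kron_one_one)+
  have At_sim: "At = T * A * Tinv"
    unfolding At_def T_def Aa Tinv_def a'_def kron_one_mult[OF t a]
    by (rule kron_one_mult[OF mult_carrier_mat[OF t a] tinv, symmetric])
  have TB: "Bt = T * B"
    unfolding Bt_def T_def Bb by (rule kron_one_mult[OF t b, symmetric])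
  have CT: "Ct = C * Tinv"
    unfolding Ct_def Cc Tinv_def by (rule kron_one_mult[OF c tinv, symmetric])

  have At_index: "At $$ (i, j) = (if i mod d = j mod d then a' $$ (i div d, j div d) else 0)"
    if "i < n * d" "j < n * d" for i j
    unfolding At_def using that a' by (intro kron_one_index) auto
  have A11_index: "A11 $$ (i, j) = At $$ (i, j)" if i: "i < r * d" and j: "j < r * d" for i j
  proof -
    note bi = block_pos[OF i] and bj = block_pos[OF j]
    have At_ij: "At $$ (i, j) = (if i mod d = j mod d then a' $$ (i div d, j div d) else 0)"
      using i j nd by (intro At_index) auto
    show ?thesis
    proof (cases "i div d")
      case 0
      then show ?thesis using i j bi bj At_ij by (simp add: A11_def block_mat_index S_def)
    next
      case (Suc p)
      then have "a' $$ (i div d, j div d) = (if p = j div d then 1 else 0)"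
        unfolding a'_def using bi bj rn shift[of p "j div d"] by simp
      then show ?thesis using i j bi bj At_ij Suc by (simp add: A11_def block_mat_index)
    qed
  qed
  have A12_index: "A12 $$ (i, j) = At $$ (i, r * d + j)" if i: "i < r * d" and j: "j < (n - r) * d" for i j
  proof -
    note bi = block_pos[OF i] and bj = block_pos[OF j]
    have At_ij: "At $$ (i, r * d + j) = (if i mod d = j mod d then a' $$ (i div d, r + j div d) else 0)"
      using i j nd d At_index[of i "r * d + j"] by simp
    show ?thesis
    proof (cases "i div d")
      case 0
      then show ?thesis using i j bi bj At_ij by (simp add: A12_def block_mat_index S'_def)
    next
      case (Suc p)
      then have "a' $$ (i div d, r + j div d) = 0"
        unfolding a'_def using bi bj shift[of p "r + j div d"] by simp
      then show ?thesis using i j bi bj At_ij Suc by (simp add: A12_def block_mat_index)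
    qed
  qed
  have At_blocks: "At = four_block_mat A11 A12 A21 A22"
  proof (rule eq_matI)
    fix i j
    assume "i < dim_row (four_block_mat A11 A12 A21 A22)" "j < dim_col (four_block_mat A11 A12 A21 A22)"
    then have ij: "i < r * d + (n - r) * d" "j < r * d + (n - r) * d" using A11 A22 by auto
    have "four_block_mat A11 A12 A21 A22 $$ (i, j) =
      (if i < r * d then if j < r * d then A11 $$ (i, j) else A12 $$ (i, j - r * d)
       else if j < r * d then A21 $$ (i - r * d, j) else A22 $$ (i - r * d, j - r * d))"
      using ij A11 A22 by simp
    also have "\<dots> = At $$ (i, j)"
      using ij A11_index[of i j] A12_index[of i "j - r * d"] by (auto simp: A21_def A22_def)
    finally show "At $$ (i, j) = four_block_mat A11 A12 A21 A22 $$ (i, j)" ..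
  qed (use A11 A22 At nd in auto)

  have z: "0\<^sub>m ((n - r) * d) d \<in> carrier_mat ((n - r) * d) d"
    "0\<^sub>m d ((n - r) * d) \<in> carrier_mat d ((n - r) * d)" by auto
  have Bt_index: "Bt $$ (i, j) = (if i mod d = j \<and> i div d = 0 then h else 0)"
    if i: "i < n * d" and j: "j < d" for i j
    unfolding Bt_def using i j t b d tb block_pos[OF i] by (simp add: kron_one_index h_def del: index_mult_mat(1))
  have B1_index: "B1 $$ (i, j) = (if i mod d = j \<and> i div d = 0 then h else 0)"
    if i: "i < r * d" and j: "j < d" for i j
  proof -
    have "B1 $$ (i, j) = mat_of_cols r [unit_vec r 0] $$ (i div d, 0) * (C * A ^\<^sub>m (r - 1) * B) $$ (i mod d, j)"
      unfolding B1_def using i j B C by (subst kron_index) (simp_all del: index_mult_mat(1))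
    also have "(C * A ^\<^sub>m (r - 1) * B) $$ (i mod d, j) = (if i mod d = j then h else 0)"
      unfolding CAB using i j b c d by (subst kron_one_index) (simp_all add: h_def del: index_mult_mat(1))
    also have "mat_of_cols r [unit_vec r 0] $$ (i div d, 0) = (if i div d = 0 then 1 else (0 :: real))"
      using block_pos[OF i] by (subst mat_of_cols_index) auto
    finally show ?thesis by simp
  qed
  have Bt_blocks: "Bt = B1 @\<^sub>r 0\<^sub>m ((n - r) * d) d"
  proof (rule eq_matI)
    have c': "B1 @\<^sub>r 0\<^sub>m ((n - r) * d) d \<in> carrier_mat (n * d) d"
      unfolding nd by (rule carrier_append_rows[OF B1 z(1)])
    then show "dim_row Bt = dim_row (B1 @\<^sub>r 0\<^sub>m ((n - r) * d) d)"
      "dim_col Bt = dim_col (B1 @\<^sub>r 0\<^sub>m ((n - r) * d) d)" using Bt by auto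
    fix i j
    assume "i < dim_row (B1 @\<^sub>r 0\<^sub>m ((n - r) * d) d)" "j < dim_col (B1 @\<^sub>r 0\<^sub>m ((n - r) * d) d)"
    then have i: "i < n * d" and j: "j < d" using c' by auto
    have "i div d \<noteq> 0" if "\<not> i < r * d"
    proof -
      have "d \<le> i" using mult_le_mono1[OF r, of d] that by linarith
      then show ?thesis using d by (simp add: div_eq_0_iff)
    qed
    then have "Bt $$ (i, j) = (if i < r * d then B1 $$ (i, j) else 0\<^sub>m ((n - r) * d) d $$ (i - r * d, j))"
      using i j nd Bt_index[OF i j] B1_index[of i j] by auto
    then show "Bt $$ (i, j) = (B1 @\<^sub>r 0\<^sub>m ((n - r) * d) d) $$ (i, j)"
      using append_rows_index[OF B1 z(1), of i j] i j nd by simp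
  qed

  have Ct_index: "Ct $$ (i, j) = (if i = j mod d \<and> j div d = r - 1 then 1 else 0)"
    if i: "i < d" and j: "j < n * d" for i j
  proof -
    have "Ct $$ (i, j) = (if i mod d = j mod d then (c * tinv) $$ (i div d, j div d) else 0)"
      unfolding Ct_def using i j c tinv by (intro kron_one_index) auto
    moreover have "i mod d = i" and "i div d = 0" using i by auto
    ultimately show ?thesis by (simp only: reads[OF block_pos(2)[OF j]]) simp
  qed
  have Ct_blocks: "Ct = C1 @\<^sub>c 0\<^sub>m d ((n - r) * d)"
  proof (rule eq_matI)
    have c': "C1 @\<^sub>c 0\<^sub>m d ((n - r) * d) \<in> carrier_mat d (n * d)"
      unfolding nd by (rule append_cols_carrier[OF C1 z(2)])
    then show "dim_row Ct = dim_row (C1 @\<^sub>c 0\<^sub>m d ((n - r) * d))"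
      "dim_col Ct = dim_col (C1 @\<^sub>c 0\<^sub>m d ((n - r) * d))" using Ct by auto
    fix i j
    assume "i < dim_row (C1 @\<^sub>c 0\<^sub>m d ((n - r) * d))" "j < dim_col (C1 @\<^sub>c 0\<^sub>m d ((n - r) * d))"
    then have i: "i < d" and j: "j < n * d" using c' by auto
    have "C1 $$ (i, j) = (if i = j mod d \<and> j div d = r - 1 then 1 else 0)" if "j < r * d"
      unfolding C1_def using i that block_pos[OF that] by (subst block_mat_index) auto
    moreover have "j div d \<noteq> r - 1" if "\<not> j < r * d"
    proof -
      have "r \<le> j div d" using that d by (simp add: less_eq_div_iff_mult_less_eq)
      then show ?thesis using r by simp
    qed
    ultimately have "Ct $$ (i, j) = (if j < r * d then C1 $$ (i, j) else 0\<^sub>m d ((n - r) * d) $$ (i, j - r * d))"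
      using i j nd Ct_index[OF i j] by auto
    then show "Ct $$ (i, j) = (C1 @\<^sub>c 0\<^sub>m d ((n - r) * d)) $$ (i, j)"
      using append_cols_index[OF C1 z(2), of i j] i j nd by simp
  qed

  have trajectories: "\<exists>\<xi>2. \<forall>k. \<xi>2 k \<in> carrier_vec ((n - r) * d) \<and>
      T *\<^sub>v \<xi> k = output_stack r d y k @\<^sub>v \<xi>2 k \<and>
      (output_stack r d y (k + 1) @\<^sub>v \<xi>2 (k + 1)) @\<^sub>v y k =
        four_block_mat At Bt Ct (0\<^sub>m d d) *\<^sub>v ((output_stack r d y k @\<^sub>v \<xi>2 k) @\<^sub>v u k)"
    if traj: "lti_trajectory A B C \<xi> u y" for \<xi> u y
  proof -
    have \<xi>: "\<xi> k \<in> carrier_vec (n * d)" and u: "u k \<in> carrier_vec d"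
      and step: "\<xi> (Suc k) = A *\<^sub>v \<xi> k + B *\<^sub>v u k" and out: "y k = C *\<^sub>v \<xi> k" for k
      using traj A B by (auto simp: lti_trajectory_def)
    define \<xi>2 where "\<xi>2 = (\<lambda>k. vec ((n - r) * d) (\<lambda>i. (T *\<^sub>v \<xi> k) $ (r * d + i)))"
    have top: "(T *\<^sub>v \<xi> k) $ i = output_stack r d y k $ i" if i: "i < r * d" for i k
    proof -
      let ?p = "r - 1 - i div d"
      note bi = block_pos[OF i]
      \<comment> \<open>Block row \<open>i div d\<close> of \<open>T\<close> is \<open>C * A ^\<^sub>m ?p\<close>, which turns the state into an output
        \<open>?p < r\<close> steps ahead.\<close>
      have ind: "i < n * d" using i nd by simp
      have T_row: "T $$ (i, j) = (C * A ^\<^sub>m ?p) $$ (i mod d, j)" if j: "j < n * d" for j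
      proof -
        have "T $$ (i, j) = (if i mod d = j mod d then t $$ (i div d, j div d) else 0)"
          unfolding T_def using ind j t by (intro kron_one_index) auto
        moreover have "(C * A ^\<^sub>m ?p) $$ (i mod d, j) =
            (if i mod d mod d = j mod d then (c * a ^\<^sub>m ?p) $$ (i mod d div d, j div d) else 0)"
          unfolding CA using bi j cap[of ?p] by (intro kron_one_index) auto
        moreover have "i mod d mod d = i mod d" "i mod d div d = 0" using d by auto
        moreover have "t $$ (i div d, j div d) = (c * a ^\<^sub>m ?p) $$ (0, j div d)"
          using rows bi block_pos[OF j] by blast
        ultimately show ?thesis by (simp only:)
      qed
      have CAp: "C * A ^\<^sub>m ?p \<in> carrier_mat d (n * d)" using A C by auto
      have "row T i $ j = row (C * A ^\<^sub>m ?p) (i mod d) $ j" if j: "j < n * d" for j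
        using T_row[OF j] j ind bi carrier_matD[OF T] carrier_matD[OF CAp]
        by (simp only: index_row(1))
      then have "row T i = row (C * A ^\<^sub>m ?p) (i mod d)"
        by (intro eq_vecI) (simp_all only: index_row(2) carrier_matD[OF T] carrier_matD[OF CAp])
      then have "(T *\<^sub>v \<xi> k) $ i = ((C * A ^\<^sub>m ?p) *\<^sub>v \<xi> k) $ (i mod d)"
        using ind bi by (simp only: index_mult_mat_vec carrier_matD[OF T] carrier_matD[OF CAp])
      also have "(C * A ^\<^sub>m ?p) *\<^sub>v \<xi> k = y (k + ?p)"
        using r by (intro output_before_relative_degree[OF A B C deg traj, symmetric]) simp
      also have "k + ?p = k + r - 1 - i div d" using bi by simp
      finally show ?thesis using i by (simp add: output_stack_def)
    qed
    have split: "T *\<^sub>v \<xi> k = output_stack r d y k @\<^sub>v \<xi>2 k" for k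
    proof (rule eq_vecI)
      fix i assume "i < dim_vec (output_stack r d y k @\<^sub>v \<xi>2 k)"
      then have "i < r * d + (n - r) * d" by (simp add: output_stack_def \<xi>2_def)
      then show "(T *\<^sub>v \<xi> k) $ i = (output_stack r d y k @\<^sub>v \<xi>2 k) $ i"
        using top[of i k] by (auto simp: output_stack_def \<xi>2_def simp del: index_mult_mat_vec)
    qed (use T nd in \<open>simp add: output_stack_def \<xi>2_def\<close>)
    have next_state: "T *\<^sub>v \<xi> (Suc k) = At *\<^sub>v (T *\<^sub>v \<xi> k) + Bt *\<^sub>v u k" for k
    proof -
      have "At * T = T * A"
      proof -
        have "At * T = (T * A) * (Tinv * T)"
          unfolding At_sim by (rule assoc_mult_mat[OF mult_carrier_mat[OF T A] Tinv T])
        then show ?thesis using inverses right_mult_one_mat[OF mult_carrier_mat[OF T A]] by simp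
      qed
      then have "At *\<^sub>v (T *\<^sub>v \<xi> k) = T *\<^sub>v (A *\<^sub>v \<xi> k)"
        using assoc_mult_mat_vec[OF At T \<xi>[of k]] assoc_mult_mat_vec[OF T A \<xi>[of k]] by simp
      moreover have "Bt *\<^sub>v u k = T *\<^sub>v (B *\<^sub>v u k)"
        unfolding TB by (rule assoc_mult_mat_vec[OF T B u])
      ultimately show ?thesis
        unfolding step
        using mult_add_distrib_mat_vec[OF T mult_mat_vec_carrier[OF A \<xi>] mult_mat_vec_carrier[OF B u]]
        by simp
    qed
    have out_eq: "y k = Ct *\<^sub>v (T *\<^sub>v \<xi> k) + 0\<^sub>m d d *\<^sub>v u k" for k
    proof -
      have "Ct * T = C * (Tinv * T)" unfolding CT by (rule assoc_mult_mat[OF C Tinv T])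
      then have "Ct * T = C" using inverses right_mult_one_mat[OF C] by simp
      then have "Ct *\<^sub>v (T *\<^sub>v \<xi> k) = y k"
        using assoc_mult_mat_vec[OF Ct T \<xi>[of k]] out by simp
      moreover have "0\<^sub>m d d *\<^sub>v u k = 0\<^sub>v d"
        using u[of k] by (intro eq_vecI) (auto simp: scalar_prod_def)
      moreover have "y k \<in> carrier_vec d" unfolding out by (rule mult_mat_vec_carrier[OF C \<xi>])
      ultimately show ?thesis by simp
    qed
    show ?thesis
    proof (intro exI[of _ \<xi>2] allI conjI)
      fix k
      show "\<xi>2 k \<in> carrier_vec ((n - r) * d)" by (simp add: \<xi>2_def)
      show "T *\<^sub>v \<xi> k = output_stack r d y k @\<^sub>v \<xi>2 k" by (rule split)
      have "four_block_mat At Bt Ct (0\<^sub>m d d) *\<^sub>v ((T *\<^sub>v \<xi> k) @\<^sub>v u k) = (T *\<^sub>v \<xi> (Suc k)) @\<^sub>v y k"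
        using four_block_mat_mult_vec[OF At Bt Ct zero_carrier_mat mult_mat_vec_carrier[OF T \<xi>[of k]] u[of k]]
        by (simp only: next_state flip: out_eq)
      then show "(output_stack r d y (k + 1) @\<^sub>v \<xi>2 (k + 1)) @\<^sub>v y k =
        four_block_mat At Bt Ct (0\<^sub>m d d) *\<^sub>v ((output_stack r d y k @\<^sub>v \<xi>2 k) @\<^sub>v u k)"
        by (simp only: split Suc_eq_plus1)
    qed
  qed

  have sim: "similar_mat_wit At A T Tinv"
    by (rule similar_mat_witI[OF inverses At_sim At A T Tinv])
  show ?thesis
    apply (rule conjI[OF rn])
    apply (rule exI[of _ T], rule exI[of _ Tinv], rule exI[of _ At], rule exI[of _ Bt], rule exI[of _ Ct])
    apply (rule exI[of _ A11], rule exI[of _ A12], rule exI[of _ A21], rule exI[of _ A22])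
    apply (rule exI[of _ B1], rule exI[of _ C1], rule exI[of _ S], rule exI[of _ S'])
    apply (intro conjI)
    subgoal by (simp add: S_def)
    subgoal by (simp add: S'_def)
    subgoal by (rule A11_def)
    subgoal by (rule A12_def)
    subgoal by (rule A21)
    subgoal by (rule A22)
    subgoal by (rule B1_def)
    subgoal by (rule C1_def)
    subgoal by (rule At_blocks)
    subgoal by (rule Bt_blocks)
    subgoal by (rule Ct_blocks)
    subgoal by (rule sim)
    subgoal by (rule TB)
    subgoal by (rule CT)
    subgoal using trajectories by (intro allI impI)
    done
qed

end
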